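(* Let $f, f_1,\ldots,f_m\in\mathbb{R}[x]=\mathbb{R}[x_1,\ldots,x_n]$ with no $f_j$ ($1\le j\le m$) identically zero, let $K=\{x\in\mathbb{R}^n : f_j(x)\ge 0,\ j=1,\ldots,m\}$, and suppose that the problem of minimizing $f$ over $K$ has an optimal solution $x^*$. Put $b=\max(1,\max_i |x_i^*|)$, $B=[-b,b]^n$, $\bar K = B\cap K$, and $R_j=\max\{|f_j(x)| : x\in B\}$. For positive integers $r$ let $$\psi_r(x) = -\sum_{j=1}^m f_j(x)\left(1-\frac{f_j(x)}{R_j}\right)^{2r},\qquad \Theta_{r,b}(x)=1+\sum_{i=1}^n\left(\frac{x_i}{b}\right)^{2r}.$$ Let $\rho\in\mathbb{R}$ be such that $f(x)-\rho>0$ for every $x\in\bar K$. Then: (i) There exists $\tilde r\in\mathbb{N}$ such that for all $r\ge\tilde r$, the polynomial $f-\rho+\psi_r$ is positive on $B$. (ii) In addition, with this $\tilde r$, for every $\epsilon>0$ there exists a positive integer $\hat r$ such that for every $r\ge\hat r$, $$f-\rho+\epsilon\,\Theta_{r,b}+\psi_{\tilde r}\in\Sigma .$$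
   Context: $\Sigma\subset\mathbb{R}[x]$ denotes the set of sums of squares of real polynomials. *)

theory Defs
  imports "HOL-Analysis.Analysis" "HOL-Library.Poly_Mapping"
begin

text \<open>The ring \<open>\<real>[x\<^sub>i : i \<in> 'n]\<close> is the monoid algebra of the exponent vectors
  \<open>'n \<Rightarrow>\<^sub>0 nat\<close>; addition and multiplication are those of \<open>Poly_Mapping\<close>.\<close>

type_synonym 'n real_mpoly = "('n \<Rightarrow>\<^sub>0 nat) \<Rightarrow>\<^sub>0 real"

definition const_mpoly :: "real \<Rightarrow> 'n real_mpoly" where
  "const_mpoly c = Poly_Mapping.single 0 c"

definition var_mpoly :: "'n \<Rightarrow> 'n real_mpoly" where
  "var_mpoly i = Poly_Mapping.single (Poly_Mapping.single i 1) 1"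

definition eval_mpoly :: "'n::finite real_mpoly \<Rightarrow> real ^ 'n \<Rightarrow> real" where
  "eval_mpoly p x =
     (\<Sum>\<alpha>\<in>Poly_Mapping.keys p. Poly_Mapping.lookup p \<alpha> *
        (\<Prod>i\<in>UNIV. (x $ i) ^ Poly_Mapping.lookup \<alpha> i))"

definition sums_of_squares :: "'n real_mpoly set" where
  "sums_of_squares = {p. \<exists>qs. p = (\<Sum>q\<leftarrow>qs. q ^ 2)}"

definition feasible_set :: "nat \<Rightarrow> (nat \<Rightarrow> 'n::finite real_mpoly) \<Rightarrow> (real ^ 'n) set" where
  "feasible_set m g = {x. \<forall>j\<in>{1..m}. eval_mpoly (g j) x \<ge> 0}"

text \<open>On a nonempty compact set the supremum below is attained, i.e. it is a maximum.\<close>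

definition max_abs_on :: "(real ^ 'n) set \<Rightarrow> 'n::finite real_mpoly \<Rightarrow> real" where
  "max_abs_on B p = (SUP x\<in>B. \<bar>eval_mpoly p x\<bar>)"

definition psi :: "nat \<Rightarrow> (nat \<Rightarrow> 'n real_mpoly) \<Rightarrow> (nat \<Rightarrow> real) \<Rightarrow> nat \<Rightarrow> 'n real_mpoly" where
  "psi m g R r = - (\<Sum>j=1..m. g j * (1 - const_mpoly (1 / R j) * g j) ^ (2 * r))"

definition Theta :: "nat \<Rightarrow> real \<Rightarrow> 'n::finite real_mpoly" where
  "Theta r b = 1 + (\<Sum>i\<in>UNIV. (const_mpoly (1 / b) * var_mpoly i) ^ (2 * r))"

end

theory Submission
  imports Defs
begin

text \<open>
  On \<open>B\<close> the polynomial \<open>\<psi>\<^sub>r\<close> is at least \<open>- O(1/r)\<close> plus \<open>r\<close> times a multiple of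
  \<open>\<Sum>\<^sub>j min(0, g\<^sub>j)\<^sup>2\<close>, a function that vanishes on \<open>B\<close> exactly at the points of \<open>B \<inter> K\<close>; compactness gives (i).

  For (ii), let \<open>y\<^sub>i = x\<^sub>i / b\<close> and consider the closure of the cone of sums of squares in the
  \<open>\<ell>\<^sub>1\<close>-norm of the coefficients with respect to the monomials in \<open>y\<close>. It is closed under products and
  contains \<open>1 \<plusminus> y\<^sub>i\<close>, as \<open>\<surd>(1 \<plusminus> t)\<close> is a limit of polynomials in this norm. A polynomial positive on
  \<open>B\<close> has nonnegative Bernstein coefficients in a sufficiently high degree, hence is a nonnegative
  combination of products of the \<open>1 \<plusminus> y\<^sub>i\<close> and lies in the closure. Finally \<open>\<epsilon> \<Theta>\<close> absorbs every
  error that is small in \<open>\<ell>\<^sub>1\<close>, whatever its degree, once the degree of \<open>\<Theta>\<close> is large enough.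
\<close>

subsection \<open>Polynomials as polynomial functions\<close>

lemma const_mpoly_0 [simp]: "const_mpoly 0 = 0"
  by (simp add: const_mpoly_def)

lemma const_mpoly_1 [simp]: "const_mpoly 1 = 1"
  by (simp add: const_mpoly_def)

lemma const_mpoly_add: "const_mpoly (a + b) = const_mpoly a + const_mpoly b"
  by (simp add: const_mpoly_def single_add)

lemma const_mpoly_minus: "const_mpoly (- a) = - const_mpoly a"
  by (simp add: const_mpoly_def single_uminus)

lemma const_mpoly_diff: "const_mpoly (a - b) = const_mpoly a - const_mpoly b"
  by (simp add: const_mpoly_def single_diff)

lemma const_mpoly_mult: "const_mpoly (a * b) = const_mpoly a * const_mpoly b"
  by (simp add: const_mpoly_def mult_single)

lemma const_mpoly_prod: "const_mpoly (prod f A) = (\<Prod>i\<in>A. const_mpoly (f i))"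
  by (induction A rule: infinite_finite_induct) (simp_all add: const_mpoly_mult)

lemma const_mpoly_of_nat: "const_mpoly (of_nat n) = of_nat n"
  by (induction n) (simp_all add: const_mpoly_add)

lemma mpoly_induct_single [case_names zero add]:
  fixes p :: "'n real_mpoly"
  assumes "P 0" and add: "\<And>p a c. P p \<Longrightarrow> P (p + Poly_Mapping.single a c)"
  shows "P p"
proof (induction p rule: update_induct)
  case (update f a b)
  \<comment> \<open>The key \<open>a\<close> is absent from \<open>f\<close>, so overwriting its
    coefficient 0 is the same as adding a term.\<close>
  have "Poly_Mapping.update a b f = f + Poly_Mapping.single a b"
    using update(1)
    by (intro poly_mapping_eqI)
      (auto simp: lookup_update lookup_add lookup_single when_def in_keys_iff)
  with add[OF update(3)] show ?case by simp
qed (fact assms(1))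

lemma var_mpoly_power: "var_mpoly i ^ k = Poly_Mapping.single (Poly_Mapping.single i k) 1"
  by (induction k) (simp_all add: var_mpoly_def mult_single flip: single_add)

lemma single_eq_monomial:
  fixes a :: "'n::finite \<Rightarrow>\<^sub>0 nat"
  shows "Poly_Mapping.single a c
    = const_mpoly c * (\<Prod>i\<in>UNIV. var_mpoly i ^ Poly_Mapping.lookup a i)"
proof -
  have *: "(\<Prod>i\<in>I. Poly_Mapping.single (h i) (1::real)) = Poly_Mapping.single (\<Sum>i\<in>I. h i) 1"
    for I and h :: "'n \<Rightarrow> 'n \<Rightarrow>\<^sub>0 nat"
    by (induction I rule: infinite_finite_induct) (simp_all add: mult_single)
  have "(\<Sum>i\<in>UNIV. Poly_Mapping.single i (Poly_Mapping.lookup a i)) = a"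
    by (intro poly_mapping_eqI) (simp add: lookup_sum lookup_single when_def)
  then show ?thesis
    by (simp add: const_mpoly_def var_mpoly_power * mult_single)
qed

text \<open>Constants and variables generate the polynomial ring. This form suits properties stable
  under the ring operations, such as admitting some \<open>ell1\<close> bound.\<close>

lemma mpoly_induct [case_names const var add mult]:
  fixes p :: "'n::finite real_mpoly"
  assumes const: "\<And>c. P (const_mpoly c)" and var: "\<And>i. P (var_mpoly i)"
    and add: "\<And>p q. P p \<Longrightarrow> P q \<Longrightarrow> P (p + q)"
    and mult: "\<And>p q. P p \<Longrightarrow> P q \<Longrightarrow> P (p * q)"
  shows "P p"
proof (induction p rule: mpoly_induct_single)
  case zero
  show ?case using const[of 0] by simp
next
  case (add p a c)
  have pow: "P (q ^ k)" if "P q" for q k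
    by (induction k) (use const[of 1] mult that in auto)
  have "P (\<Prod>i\<in>I. var_mpoly i ^ Poly_Mapping.lookup a i)" for I
    by (induction I rule: infinite_finite_induct) (use const[of 1] mult var pow in auto)
  with const mult have "P (Poly_Mapping.single a c)"
    unfolding single_eq_monomial by blast
  with add show ?case using assms(3) by blast
qed

lemma eval_mpoly_single:
  "eval_mpoly (Poly_Mapping.single a c) x = c * (\<Prod>i\<in>UNIV. (x $ i) ^ Poly_Mapping.lookup a i)"
  by (simp add: eval_mpoly_def)

lemma eval_mpoly_0 [simp]: "eval_mpoly 0 x = 0"
  by (simp add: eval_mpoly_def)

lemma eval_mpoly_const [simp]: "eval_mpoly (const_mpoly c) x = c"
  by (simp add: const_mpoly_def eval_mpoly_single)

lemma eval_mpoly_1 [simp]: "eval_mpoly 1 x = 1"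
  using eval_mpoly_const[of 1 x] by simp

lemma eval_mpoly_var [simp]: "eval_mpoly (var_mpoly i) x = x $ i"
proof -
  have "(\<Prod>j\<in>UNIV. (x $ j) ^ Poly_Mapping.lookup (Poly_Mapping.single i 1) j)
      = (\<Prod>j\<in>UNIV. if j = i then x $ j else 1)"
    by (intro prod.cong) (auto simp: lookup_single when_def)
  then show ?thesis
    by (simp add: var_mpoly_def eval_mpoly_single)
qed

lemma eval_mpoly_add [simp]: "eval_mpoly (p + q) x = eval_mpoly p x + eval_mpoly q x"
  unfolding eval_mpoly_def by (rule setsum_keys_plus_distrib) (auto simp: algebra_simps)

lemma eval_mpoly_minus [simp]: "eval_mpoly (- p) x = - eval_mpoly p x"
  using eval_mpoly_add[of p "- p" x] by simp

lemma eval_mpoly_diff [simp]: "eval_mpoly (p - q) x = eval_mpoly p x - eval_mpoly q x"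
  using eval_mpoly_add[of p "- q" x] by simp

lemma eval_mpoly_mult [simp]: "eval_mpoly (p * q) x = eval_mpoly p x * eval_mpoly q x"
proof (induction p rule: mpoly_induct_single)
  case (add p a c)
  have "eval_mpoly (Poly_Mapping.single a c * q) x = eval_mpoly (Poly_Mapping.single a c) x * eval_mpoly q x"
  proof (induction q rule: mpoly_induct_single)
    case (add q b d)
    then show ?case
      by (simp add: distrib_left mult_single eval_mpoly_single lookup_add power_add prod.distrib)
  qed simp
  with add show ?case by (simp add: distrib_right)
qed simp

lemma eval_mpoly_power [simp]: "eval_mpoly (p ^ k) x = eval_mpoly p x ^ k"
  by (induction k) simp_all

lemma eval_mpoly_sum [simp]: "eval_mpoly (sum p A) x = (\<Sum>i\<in>A. eval_mpoly (p i) x)"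
  by (induction A rule: infinite_finite_induct) simp_all

lemma eval_mpoly_prod [simp]: "eval_mpoly (prod p A) x = (\<Prod>i\<in>A. eval_mpoly (p i) x)"
  by (induction A rule: infinite_finite_induct) simp_all

lemma continuous_on_eval_mpoly: "continuous_on S (eval_mpoly p)"
  unfolding eval_mpoly_def by (intro continuous_intros)

subsection \<open>Sums of squares\<close>

lemma sos_square: "q ^ 2 \<in> sums_of_squares"
  unfolding sums_of_squares_def by (intro CollectI exI[of _ "[q]"]) simp

lemma sos_0 [simp]: "0 \<in> sums_of_squares"
  using sos_square[of 0] by simp

lemma sos_1 [simp]: "1 \<in> sums_of_squares"
  using sos_square[of 1] by simp

lemma sos_add: "p \<in> sums_of_squares \<Longrightarrow> q \<in> sums_of_squares \<Longrightarrow> p + q \<in> sums_of_squares"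
  unfolding sums_of_squares_def
proof clarify
  fix ps qs :: "'a real_mpoly list"
  show "\<exists>rs. (\<Sum>q\<leftarrow>ps. q\<^sup>2) + (\<Sum>q\<leftarrow>qs. q\<^sup>2) = (\<Sum>q\<leftarrow>rs. q\<^sup>2)"
    by (intro exI[of _ "ps @ qs"]) simp
qed

lemma sos_sum: "(\<And>i. i \<in> A \<Longrightarrow> p i \<in> sums_of_squares) \<Longrightarrow> sum p A \<in> sums_of_squares"
  by (induction A rule: infinite_finite_induct) (auto intro: sos_add)

lemma sos_mult:
  assumes "p \<in> sums_of_squares" "q \<in> sums_of_squares"
  shows "p * q \<in> sums_of_squares"
proof -
  \<comment> \<open>By commutativity \<open>r\<close> can be absorbed into every square of
    \<open>p\<close>; the general case follows by distributing over the squares of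
    \<open>q\<close>.\<close>
  have square: "p * r\<^sup>2 \<in> sums_of_squares" for r
  proof -
    obtain ps where "p = (\<Sum>q\<leftarrow>ps. q\<^sup>2)"
      using assms(1) by (auto simp: sums_of_squares_def)
    then have "p * r\<^sup>2 = (\<Sum>q\<leftarrow>map (\<lambda>q. q * r) ps. q\<^sup>2)"
      by (simp add: o_def power_mult_distrib sum_list_mult_const)
    then show ?thesis
      unfolding sums_of_squares_def by blast
  qed
  obtain qs where "q = (\<Sum>q\<leftarrow>qs. q\<^sup>2)"
    using assms(2) by (auto simp: sums_of_squares_def)
  moreover have "p * (\<Sum>q\<leftarrow>qs. q\<^sup>2) \<in> sums_of_squares"
    by (induction qs) (auto simp: distrib_left intro: sos_add square)
  ultimately show ?thesis by simp
qed

lemma sos_power: "p \<in> sums_of_squares \<Longrightarrow> p ^ k \<in> sums_of_squares"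
  by (induction k) (auto intro: sos_mult)

lemma sos_const: "c \<ge> 0 \<Longrightarrow> const_mpoly c \<in> sums_of_squares"
  using sos_square[of "const_mpoly (sqrt c)"]
  by (simp add: power2_eq_square flip: const_mpoly_mult)

text \<open>Both differences have the factor \<open>a - b\<close>, which therefore occurs squared;
  the cofactors are sums of products of powers of \<open>a\<close> and \<open>b\<close>. This is the
  algebraic counterpart of both powers being increasing on the nonnegative reals.\<close>

lemma sos_power_diff_mult:
  assumes "a \<in> sums_of_squares" "b \<in> sums_of_squares"
  shows "(a ^ k - b ^ k) * (a ^ l - b ^ l) \<in> sums_of_squares"
proof -
  define h where "h k = (\<Sum>i<k. b ^ (k - Suc i) * a ^ i)" for k
  have "a ^ k - b ^ k = (a - b) * h k" for k
    unfolding h_def by (rule power_diff_sumr2)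
  then have "(a ^ k - b ^ k) * (a ^ l - b ^ l) = (a - b)\<^sup>2 * (h k * h l)"
    by (simp add: power2_eq_square ac_simps)
  moreover have "h k \<in> sums_of_squares" for k
    unfolding h_def using assms by (intro sos_sum sos_mult sos_power)
  ultimately show ?thesis by (simp add: sos_mult sos_square)
qed

text \<open>Expanding the product of the previous lemma leaves two mixed terms; one is kept, the
  other is a product of sums of squares and can be added back.\<close>

lemma sos_sum_powers_minus_mixed:
  assumes "a \<in> sums_of_squares" "b \<in> sums_of_squares"
  shows "a ^ (k + l) + b ^ (k + l) - a ^ k * b ^ l \<in> sums_of_squares"
proof -
  have "a ^ (k + l) + b ^ (k + l) - a ^ k * b ^ l = (a ^ k - b ^ k) * (a ^ l - b ^ l) + a ^ l * b ^ k"
    by (simp add: algebra_simps power_add)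
  then show ?thesis
    using assms by (simp add: sos_add sos_mult sos_power sos_power_diff_mult)
qed

text \<open>A crude arithmetic-geometric mean inequality; what matters is that \<open>C\<close> does not depend on
  the degrees \<open>a\<close> and \<open>r\<close>.\<close>

lemma sos_monomial_bound:
  assumes z: "\<And>i. z i \<in> sums_of_squares" and "finite I"
  shows "\<exists>C\<ge>0. \<forall>a r. sum a I \<le> r \<longrightarrow>
    const_mpoly C * (1 + (\<Sum>i\<in>I. z i ^ r)) - (\<Prod>i\<in>I. z i ^ a i) \<in> sums_of_squares"
  using \<open>finite I\<close>
proof (induction I rule: finite_induct)
  case empty
  show ?case by (intro exI[of _ 1]) simp
next
  case (insert j I)
  obtain C where C: "C \<ge> 0" and IH: "\<And>a r. sum a I \<le> r \<Longrightarrow>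
      const_mpoly C * (1 + (\<Sum>i\<in>I. z i ^ r)) - (\<Prod>i\<in>I. z i ^ a i) \<in> sums_of_squares"
    using insert.IH by blast
  \<comment> \<open>The factor \<open>1 + card I\<close> counts the comparisons collected in
    \<open>E\<close> below: each contributes one \<open>z j ^ r\<close>. The coefficients of the
    other powers are then padded from \<open>C\<close> up to \<open>D\<close>.\<close>
  define D where "D = C * (1 + card I)"
  have "const_mpoly D * (1 + (\<Sum>i\<in>insert j I. z i ^ r)) - (\<Prod>i\<in>insert j I. z i ^ a i) \<in> sums_of_squares"
    if "sum a (insert j I) \<le> r" for a r
  proof -
    \<comment> \<open>After \<open>z j ^ a j\<close> is split off, the induction hypothesis is
      applied with the remaining exponent \<open>d\<close>. Each resulting
      \<open>z j ^ a j * z i ^ d\<close> has total exponent \<open>r\<close>.\<close>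
    define d where "d = r - a j"
    have r: "r = a j + d" and d: "sum a I \<le> d"
      using that insert.hyps by (auto simp: d_def)
    define S where "S = (\<Sum>i\<in>I. z i ^ r)"
    \<comment> \<open>\<open>E\<close> is the error of replacing these mixed terms by pure
      \<open>r\<close>-th powers. The constant 1 is written as a power so that it is treated like
      one more \<open>z i\<close>.\<close>
    define E where "E = (z j ^ r + 1 ^ r - z j ^ a j * 1 ^ d)
      + (\<Sum>i\<in>I. z j ^ r + z i ^ r - z j ^ a j * z i ^ d)"
    have E: "E = 1 + of_nat (1 + card I) * z j ^ r + S - z j ^ a j * (1 + (\<Sum>i\<in>I. z i ^ d))"
      by (simp add: E_def S_def sum.distrib sum_subtractf sum_distrib_left algebra_simps)
    have "E \<in> sums_of_squares"
      unfolding E_def r by (intro sos_add sos_sum sos_sum_powers_minus_mixed z sos_1)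
    moreover have "const_mpoly D * (1 + (z j ^ r + S)) - z j ^ a j * (\<Prod>i\<in>I. z i ^ a i)
      = z j ^ a j * (const_mpoly C * (1 + (\<Sum>i\<in>I. z i ^ d)) - (\<Prod>i\<in>I. z i ^ a i))
        + const_mpoly C * E + const_mpoly C * of_nat (card I) * (1 + S)"
      unfolding E D_def const_mpoly_mult const_mpoly_add const_mpoly_of_nat
      by (simp add: algebra_simps)
    moreover have "S \<in> sums_of_squares"
      unfolding S_def by (intro sos_sum sos_power z)
    moreover have "of_nat (card I) \<in> sums_of_squares"
      using sos_const[of "real (card I)"] by (simp add: const_mpoly_of_nat)
    ultimately have "const_mpoly D * (1 + (z j ^ r + S)) - z j ^ a j * (\<Prod>i\<in>I. z i ^ a i) \<in> sums_of_squares"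
      using C by (auto intro!: sos_add sos_mult sos_power sos_const z IH[OF d])
    with insert.hyps show ?thesis by (simp add: S_def)
  qed
  moreover have "D \<ge> 0" using C by (simp add: D_def)
  ultimately show ?case by blast
qed

subsection \<open>Weighted \<open>\<ell>\<^sub>1\<close>-bounds on the coefficients\<close>

text \<open>\<open>ell1 y d p\<close>: some expansion of \<open>p\<close> in monomials of the elements \<open>y i\<close> has coefficients
  of total absolute value \<open>d\<close>.\<close>

inductive ell1 :: "('n::finite \<Rightarrow> 'n real_mpoly) \<Rightarrow> real \<Rightarrow> 'n real_mpoly \<Rightarrow> bool" for y where
  zero: "ell1 y 0 0"
| add_monomial: "ell1 y d p \<Longrightarrow> ell1 y (d + \<bar>c\<bar>) (p + const_mpoly c * (\<Prod>i\<in>UNIV. y i ^ a i))"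

lemma ell1_nonneg: "ell1 y d p \<Longrightarrow> d \<ge> 0"
  by (induction rule: ell1.induct) auto

lemma ell1_add:
  assumes "ell1 y d p" "ell1 y e q"
  shows "ell1 y (d + e) (p + q)"
  using assms(2)
proof (induction rule: ell1.induct)
  case (add_monomial e q c a)
  then show ?case
    using ell1.add_monomial[of y "d + e" "p + q" c a] by (simp add: add.assoc)
qed (use assms(1) in simp)

lemma ell1_monomial: "ell1 y \<bar>c\<bar> (const_mpoly c * (\<Prod>i\<in>UNIV. y i ^ a i))"
  using ell1.add_monomial[OF ell1.zero] by simp

lemma ell1_mult:
  assumes "ell1 y d p" "ell1 y e q"
  shows "ell1 y (d * e) (p * q)"
  using assms(2)
proof (induction rule: ell1.induct)
  case (add_monomial e q c a)
  have "ell1 y (d * \<bar>c\<bar>) (p * (const_mpoly c * (\<Prod>i\<in>UNIV. y i ^ a i)))"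
    using assms(1)
  proof (induction rule: ell1.induct)
    case (add_monomial d p c' a')
    have "const_mpoly c' * (\<Prod>i\<in>UNIV. y i ^ a' i) * (const_mpoly c * (\<Prod>i\<in>UNIV. y i ^ a i))
      = const_mpoly (c' * c) * (\<Prod>i\<in>UNIV. y i ^ (a' i + a i))"
      by (simp add: const_mpoly_mult power_add prod.distrib mult_ac)
    then show ?case
      using ell1_add[OF add_monomial.IH ell1_monomial[of y "c' * c" "\<lambda>i. a' i + a i"]]
      by (simp add: distrib_right abs_mult)
  qed (simp add: ell1.zero)
  with add_monomial.IH show ?case
    by (simp add: distrib_left ell1_add)
qed (simp add: ell1.zero)

lemma ell1_const: "ell1 y \<bar>c\<bar> (const_mpoly c)"
  using ell1_monomial[of y c "\<lambda>_. 0"] by simp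

lemma ell1_generator: "ell1 y 1 (y i)"
proof -
  have "(\<Prod>j\<in>UNIV. y j ^ (if j = i then 1 else 0)) = (\<Prod>j\<in>UNIV. if j = i then y j else 1)"
    by (intro prod.cong) auto
  then show ?thesis
    using ell1_monomial[of y 1 "\<lambda>j. if j = i then 1 else 0"] by simp
qed

lemma ell1_minus: "ell1 y d p \<Longrightarrow> ell1 y d (- p)"
  using ell1_mult[OF ell1_const[of y "-1"]] by (fastforce simp: const_mpoly_minus)

text \<open>Bounds survive sums and products, so having them for the variables is enough. This
  allows a change to other generators \<open>y\<close>.\<close>

lemma ell1_exists:
  assumes "\<And>i. \<exists>d. ell1 y d (var_mpoly i)"
  shows "\<exists>d. ell1 y d p"
  by (induction p rule: mpoly_induct) (use assms ell1_const ell1_add ell1_mult in blast)+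

text \<open>The square of \<open>1 \<plusminus> y\<^sup>a\<close> trades the monomial \<open>y\<^sup>a\<close> for monomials in the squares \<open>y\<^sub>i\<^sup>2\<close>.\<close>

lemma ell1_add_even_powers_sos:
  fixes y :: "'n::finite \<Rightarrow> 'n real_mpoly"
  shows "\<exists>C\<ge>0. \<forall>d e. ell1 y d e \<longrightarrow>
    (\<exists>r1. \<forall>r\<ge>r1. const_mpoly (C * d) * (1 + (\<Sum>i\<in>UNIV. y i ^ (2 * r))) + e \<in> sums_of_squares)"
proof -
  obtain C where C: "C \<ge> 0" and mono: "\<And>a r. sum a UNIV \<le> r \<Longrightarrow>
      const_mpoly C * (1 + (\<Sum>i\<in>UNIV. (y i ^ 2) ^ r)) - (\<Prod>i\<in>UNIV. (y i ^ 2) ^ a i) \<in> sums_of_squares"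
    using sos_monomial_bound[of "\<lambda>i. y i ^ 2" UNIV] sos_square by fastforce
  define T where "T r = 1 + (\<Sum>i\<in>UNIV. y i ^ (2 * r))" for r
  have T: "T r \<in> sums_of_squares" for r
    unfolding T_def power_mult by (intro sos_add sos_sum sos_power sos_square sos_1)
  \<comment> \<open>Half the sum of \<open>(1 + s * w)^2\<close>, \<open>T r - 1\<close> and
    \<open>C * T r - w^2\<close> is \<open>D * T r + s * w\<close>. Thus \<open>D\<close> depends on
    \<open>y\<close> only, and the monomials affect just the threshold for \<open>r\<close>.\<close>
  define D where "D = (1 + C) / 2"
  have "\<exists>r1. \<forall>r\<ge>r1. const_mpoly (D * d) * T r + e \<in> sums_of_squares" if "ell1 y d e" for d e
    using that
  proof (induction rule: ell1.induct)
    case (add_monomial d p c a)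
    then obtain r1 where r1: "\<And>r. r \<ge> r1 \<Longrightarrow> const_mpoly (D * d) * T r + p \<in> sums_of_squares"
      by blast
    define w where "w = (\<Prod>i\<in>UNIV. y i ^ a i)"
    have "const_mpoly (D * (d + \<bar>c\<bar>)) * T r + (p + const_mpoly c * w) \<in> sums_of_squares"
      if r: "r \<ge> max r1 (sum a UNIV)" for r
    proof -
      have w2: "w ^ 2 = (\<Prod>i\<in>UNIV. (y i ^ 2) ^ a i)"
        by (simp add: w_def prod_power_distrib power_mult [symmetric] mult.commute)
      have bound: "const_mpoly C * T r - w ^ 2 \<in> sums_of_squares"
        using mono[of a r] r by (simp add: w2 T_def power_mult)
      have "T r - 1 \<in> sums_of_squares"
        unfolding T_def power_mult by (simp add: sos_sum sos_power sos_square)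
      \<comment> \<open>The sign of \<open>c\<close>; for \<open>c = 0\<close> the value 1 is
        chosen, which keeps \<open>s * s = 1\<close>.\<close>
      define s where "s = (if c \<ge> 0 then 1 else -1 :: 'n real_mpoly)"
      have s: "s * s = 1" "const_mpoly c = s * const_mpoly \<bar>c\<bar>"
        by (auto simp: s_def const_mpoly_minus)
      have half: "const_mpoly (1 / 2) + const_mpoly (1 / 2) = (1 :: 'n real_mpoly)"
        by (simp flip: const_mpoly_add)
      have D: "const_mpoly D = const_mpoly (1 / 2) + const_mpoly (1 / 2) * const_mpoly C"
        by (simp add: D_def add_divide_distrib flip: const_mpoly_add const_mpoly_mult)
      have "const_mpoly D * T r + s * w = const_mpoly (1 / 2) *
          ((1 + s * w) ^ 2 + (T r - 1) + (const_mpoly C * T r - w ^ 2))"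
      proof -
        have "(s * w) ^ 2 = (s * s) * w ^ 2"
          by (simp add: power2_eq_square mult_ac)
        then have "(s * w) ^ 2 = w ^ 2"
          unfolding s(1) by simp
        then have "(1 + s * w) ^ 2 = 1 + 2 * (s * w) + w ^ 2"
          by (simp add: power2_sum)
        then have "const_mpoly (1 / 2) *
            ((1 + s * w) ^ 2 + (T r - 1) + (const_mpoly C * T r - w ^ 2))
          = (const_mpoly (1 / 2) + const_mpoly (1 / 2)) * (s * w) + const_mpoly D * T r"
          unfolding D by (simp add: algebra_simps)
        then show ?thesis unfolding half by simp
      qed
      moreover have "\<dots> \<in> sums_of_squares"
        by (intro sos_mult sos_const sos_add sos_square bound) (use \<open>T r - 1 \<in> _\<close> in auto)
      ultimately have "const_mpoly D * T r + s * w \<in> sums_of_squares" by simp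
      then have 1: "const_mpoly \<bar>c\<bar> * (const_mpoly D * T r + s * w) \<in> sums_of_squares"
        by (intro sos_mult sos_const) auto
      have eq: "const_mpoly (D * (d + \<bar>c\<bar>)) * T r + (p + const_mpoly c * w)
        = (const_mpoly (D * d) * T r + p) + const_mpoly \<bar>c\<bar> * (const_mpoly D * T r + s * w)"
        unfolding s(2) const_mpoly_mult const_mpoly_add by (simp add: algebra_simps)
      show ?thesis unfolding eq using r by (intro sos_add r1 1) simp
    qed
    then show ?case unfolding w_def by blast
  qed simp
  moreover have "D \<ge> 0" using C by (simp add: D_def)
  ultimately show ?thesis unfolding T_def by blast
qed

subsection \<open>The \<open>\<ell>\<^sub>1\<close>-closure of the sums of squares\<close>

definition sos_closure :: "('n::finite \<Rightarrow> 'n real_mpoly) \<Rightarrow> 'n real_mpoly set" where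
  "sos_closure y = {p. \<forall>\<delta>>0. \<exists>s\<in>sums_of_squares. \<exists>e d. ell1 y d e \<and> d \<le> \<delta> \<and> p = s + e}"

lemma sos_closureE:
  assumes "p \<in> sos_closure y" "\<delta> > 0"
  obtains s e d where "s \<in> sums_of_squares" "ell1 y d e" "d \<le> \<delta>" "p = s + e"
  using assms unfolding sos_closure_def by blast

lemma sos_closure_sos: "s \<in> sums_of_squares \<Longrightarrow> s \<in> sos_closure y"
  unfolding sos_closure_def using ell1.zero[of y] by force

lemma sos_closure_add:
  assumes "p \<in> sos_closure y" "q \<in> sos_closure y"
  shows "p + q \<in> sos_closure y"
  unfolding sos_closure_def
proof (intro CollectI allI impI)
  fix \<delta> :: real assume "\<delta> > 0"
  then have "\<delta> / 2 > 0" by simp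
  from sos_closureE[OF assms(1) this] obtain s e d
    where 1: "s \<in> sums_of_squares" "ell1 y d e" "d \<le> \<delta> / 2" "p = s + e" .
  from sos_closureE[OF assms(2) \<open>\<delta> / 2 > 0\<close>] obtain t e' d'
    where 2: "t \<in> sums_of_squares" "ell1 y d' e'" "d' \<le> \<delta> / 2" "q = t + e'" .
  from 1 2 show "\<exists>s\<in>sums_of_squares. \<exists>e d. ell1 y d e \<and> d \<le> \<delta> \<and> p + q = s + e"
    by (intro bexI[of _ "s + t"] exI[of _ "e + e'"] exI[of _ "d + d'"])
      (auto intro: sos_add ell1_add)
qed

lemma sos_closure_sum:
  "(\<And>i. i \<in> A \<Longrightarrow> p i \<in> sos_closure y) \<Longrightarrow> sum p A \<in> sos_closure y"
  by (induction A rule: infinite_finite_induct) (auto intro: sos_closure_add sos_closure_sos)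

text \<open>With \<open>p = s + e\<close> and \<open>q = t + e'\<close>, the error of
  \<open>s * t\<close> is \<open>p * e' + q * e - e * e'\<close>. Finite bounds on \<open>p\<close>
  and \<open>q\<close> make it small along with \<open>e\<close> and \<open>e'\<close>.\<close>

lemma sos_closure_mult:
  assumes p: "p \<in> sos_closure y" and q: "q \<in> sos_closure y"
    and "ell1 y P p" "ell1 y Q q"
  shows "p * q \<in> sos_closure y"
  unfolding sos_closure_def
proof (intro CollectI allI impI)
  fix \<delta> :: real assume "\<delta> > 0"
  have PQ: "P \<ge> 0" "Q \<ge> 0" using assms(3,4) by (auto dest: ell1_nonneg)
  \<comment> \<open>The error is at most \<open>P * \<eta> + Q * \<eta> + \<eta>^2\<close>; the cap
    at 1 turns the quadratic term into a linear one.\<close>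
  define \<eta> where "\<eta> = min 1 (\<delta> / (P + Q + 1))"
  have "\<eta> > 0" "\<eta> \<le> 1" using \<open>\<delta> > 0\<close> PQ by (auto simp: \<eta>_def)
  have "\<eta> \<le> \<delta> / (P + Q + 1)" by (simp add: \<eta>_def)
  then have "\<eta> * (P + Q + 1) \<le> \<delta>" using PQ by (simp add: pos_le_divide_eq)
  from sos_closureE[OF p \<open>\<eta> > 0\<close>] obtain s e d
    where 1: "s \<in> sums_of_squares" "ell1 y d e" "d \<le> \<eta>" "p = s + e" .
  from sos_closureE[OF q \<open>\<eta> > 0\<close>] obtain t e' d'
    where 2: "t \<in> sums_of_squares" "ell1 y d' e'" "d' \<le> \<eta>" "q = t + e'" .
  have d: "d \<ge> 0" "d' \<ge> 0" using 1 2 by (auto dest: ell1_nonneg)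
  have "P * d' + (Q * d + d * d') \<le> P * \<eta> + (Q * \<eta> + \<eta> * 1)"
    using 1 2 d PQ \<open>\<eta> > 0\<close> \<open>\<eta> \<le> 1\<close> by (intro add_mono mult_mono) auto
  also have "\<dots> \<le> \<delta>" using \<open>\<eta> * (P + Q + 1) \<le> \<delta>\<close> by (simp add: algebra_simps)
  finally have "P * d' + (Q * d + d * d') \<le> \<delta>" .
  moreover have "ell1 y (P * d' + (Q * d + d * d')) (p * e' + (q * e + - (e * e')))"
    using 1 2 assms by (intro ell1_add ell1_mult ell1_minus)
  moreover have "p * q = s * t + (p * e' + (q * e + - (e * e')))"
    using 1 2 by (simp add: algebra_simps)
  ultimately show "\<exists>s\<in>sums_of_squares. \<exists>e d. ell1 y d e \<and> d \<le> \<delta> \<and> p * q = s + e"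
    using sos_mult[OF 1(1) 2(1)] by blast
qed

text \<open>The iteration \<open>w \<mapsto> (t + w\<^sup>2) / 2\<close> converges to \<open>1 - \<surd>(1 - t)\<close>. Its errors
  \<open>(1 - w)\<^sup>2 - (1 - t)\<close> are bounded in \<open>\<ell>\<^sub>1\<close> by those of the scalar iteration at \<open>t = 1\<close>.\<close>

lemma one_minus_in_sos_closure:
  assumes "ell1 y 1 t"
  shows "1 - t \<in> sos_closure y"
proof -
  define w where "w = rec_nat 0 (\<lambda>_ w. const_mpoly (1/2) * (t + w ^ 2))"
  define a :: "nat \<Rightarrow> real" where "a = rec_nat 0 (\<lambda>_ a. 1/2 * (1 + a ^ 2))"
  have w_0: "w 0 = 0" and w_Suc: "w (Suc k) = const_mpoly (1/2) * (t + w k ^ 2)" for k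
    by (simp_all add: w_def)
  have a_0: "a 0 = 0" and a_Suc: "a (Suc k) = 1/2 * (1 + a k ^ 2)" for k
    by (simp_all add: a_def)
  have half: "const_mpoly (1/2) + const_mpoly (1/2) = 1"
    by (simp flip: const_mpoly_add)
  have w: "ell1 y (a k) (w k)" for k
  proof (induction k)
    case (Suc k)
    show ?case
      unfolding w_Suc a_Suc power2_eq_square
      using ell1_mult[OF ell1_const[of y "1/2"] ell1_add[OF assms ell1_mult[OF Suc Suc]]] by simp
  qed (simp add: w_0 a_0 ell1.zero)
  \<comment> \<open>Increments of both iterations factor as half of difference times sum, so the
    scalar increment bounds the polynomial one without any loss from cancellation.\<close>
  have dw: "ell1 y (a (Suc k) - a k) (w (Suc k) - w k)" for k
  proof (induction k)
    case 0
    show ?case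
      using ell1_mult[OF ell1_const[of y "1/2"] assms] by (simp add: w_0 a_0 w_Suc a_Suc)
  next
    case (Suc k)
    have "w (Suc (Suc k)) - w (Suc k)
        = const_mpoly (1/2) * ((w (Suc k) - w k) * (w (Suc k) + w k))"
      unfolding w_Suc[of "Suc k"] w_Suc[of k] by (simp add: power2_eq_square algebra_simps)
    moreover have "a (Suc (Suc k)) - a (Suc k)
        = \<bar>1/2\<bar> * ((a (Suc k) - a k) * (a (Suc k) + a k))"
      unfolding a_Suc[of "Suc k"] a_Suc[of k] by (simp add: power2_eq_square algebra_simps)
    ultimately show ?case
      using ell1_mult[OF ell1_const[of y "1/2"] ell1_mult[OF Suc ell1_add[OF w[of "Suc k"] w[of k]]]]
      by (simp only:)
  qed
  have "0 \<le> a k" for k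
    using w by (rule ell1_nonneg)
  moreover have "a k \<le> 1" for k
    by (induction k) (auto simp: a_0 a_Suc intro: power_le_one[OF \<open>0 \<le> a _\<close>])
  moreover have "incseq a"
    using dw[THEN ell1_nonneg] by (intro incseq_SucI) simp
  ultimately obtain l where "a \<longlonglongrightarrow> l"
    using incseq_convergent by blast
  \<comment> \<open>Since \<open>a\<close> is increasing and bounded by 1 it converges, so its
    increments tend to 0.\<close>
  then have lim: "(\<lambda>k. a (Suc k) - a k) \<longlonglongrightarrow> l - l"
    by (intro tendsto_diff LIMSEQ_Suc)
  show ?thesis
    unfolding sos_closure_def
  proof (intro CollectI allI impI)
    fix \<delta> :: real assume "\<delta> > 0"
    then obtain k where k: "a (Suc k) - a k < \<delta> / 2"
      using order_tendstoD(2)[OF lim, of "\<delta> / 2"] by (auto simp: eventually_sequentially)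
    define v where "v = w (Suc k) - w k"
    have v: "ell1 y (\<bar>-2\<bar> * (a (Suc k) - a k)) (const_mpoly (-2) * v)"
      unfolding v_def by (intro ell1_mult ell1_const dw)
    have two: "const_mpoly (-2) = - 2"
      using const_mpoly_minus[of 2] by (simp add: const_mpoly_def)
    \<comment> \<open>The recurrence says \<open>2 * (v + w k) = t + w k ^ 2\<close>; completing the
      square gives \<open>1 - t = (1 - w k)^2 - 2 * v\<close>. The error is twice an increment,
      hence the earlier choice of \<open>\<delta> / 2\<close>.\<close>
    have "v + w k = const_mpoly (1/2) * (t + w k ^ 2)"
      by (simp add: v_def w_Suc)
    then have "2 * (v + w k) = (const_mpoly (1/2) + const_mpoly (1/2)) * (t + w k ^ 2)"
      by (simp add: algebra_simps)
    then have "1 - t = (1 - w k) ^ 2 + - 2 * v"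
      unfolding half by (simp add: power2_diff algebra_simps)
    then show "\<exists>s\<in>sums_of_squares. \<exists>e d. ell1 y d e \<and> d \<le> \<delta> \<and> 1 - t = s + e"
      using v k by (intro bexI[OF _ sos_square[of "1 - w k"]]) (force simp: two)
  qed
qed

text \<open>An approximation error of size \<open>d\<close> is absorbed by \<open>C * d\<close>
  copies of \<open>Theta\<close>. What remains of \<open>\<epsilon>\<close> multiplies
  \<open>Theta\<close>, itself a sum of squares.\<close>

lemma sos_closure_add_Theta:
  fixes p :: "'n::finite real_mpoly"
  assumes "p \<in> sos_closure (\<lambda>i. const_mpoly (1 / b) * var_mpoly i)" and "\<epsilon> > 0"
  shows "\<exists>r1. \<forall>r\<ge>r1. p + const_mpoly \<epsilon> * Theta r b \<in> sums_of_squares"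
proof -
  define y :: "'n \<Rightarrow> 'n real_mpoly" where "y = (\<lambda>i. const_mpoly (1 / b) * var_mpoly i)"
  obtain C where C: "C \<ge> 0" and main: "\<And>d e. ell1 y d e \<Longrightarrow>
      \<exists>r1. \<forall>r\<ge>r1. const_mpoly (C * d) * (1 + (\<Sum>i\<in>UNIV. y i ^ (2 * r))) + e \<in> sums_of_squares"
    using ell1_add_even_powers_sos[of y] by blast
  \<comment> \<open>Dividing by \<open>C + 1\<close> rather than \<open>C\<close> covers
    \<open>C = 0\<close>.\<close>
  have "\<epsilon> / (C + 1) > 0" using C assms(2) by simp
  from sos_closureE[OF assms(1)[folded y_def] this] obtain s e d
    where s: "s \<in> sums_of_squares" and e: "ell1 y d e" and d: "d \<le> \<epsilon> / (C + 1)" and p: "p = s + e" .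
  have "C * d \<le> (C + 1) * d" using ell1_nonneg[OF e] by (simp add: algebra_simps)
  also have "\<dots> \<le> \<epsilon>" using d C by (simp add: field_simps)
  finally have le: "C * d \<le> \<epsilon>" .
  have Theta: "Theta r b = 1 + (\<Sum>i\<in>UNIV. y i ^ (2 * r))" for r
    by (simp add: Theta_def y_def)
  have Theta_sos: "(Theta r b :: 'n real_mpoly) \<in> sums_of_squares" for r
    unfolding Theta power_mult by (intro sos_add sos_sum sos_power sos_square sos_1)
  obtain r1 where r1: "\<And>r. r \<ge> r1 \<Longrightarrow> const_mpoly (C * d) * Theta r b + e \<in> sums_of_squares"
    using main[OF e] unfolding Theta by blast
  have "p + const_mpoly \<epsilon> * Theta r b
      = s + (const_mpoly (C * d) * Theta r b + e) + const_mpoly (\<epsilon> - C * d) * Theta r b" for r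
    unfolding p const_mpoly_diff by (simp add: algebra_simps)
  then have "p + const_mpoly \<epsilon> * Theta r b \<in> sums_of_squares" if "r \<ge> r1" for r
    using s r1[OF that] sos_mult[OF sos_const Theta_sos, of "\<epsilon> - C * d" r] le
    by (simp add: sos_add)
  then show ?thesis by blast
qed

subsection \<open>Bernstein expansions on a box\<close>

text \<open>For \<open>a \<le> k\<close> the ratio is the product of
  \<open>(k - i) / (N - i)\<close> over \<open>i < a\<close>, and each factor differs from
  \<open>k / N\<close> by at most \<open>i / N\<close>. For \<open>k < a\<close> the ratio is 0 and
  \<open>(k / N) ^ a\<close> is itself small.\<close>

lemma binomial_ratio_approx:
  assumes "k \<le> N" "a \<le> N" "N > 0"
  shows "\<bar>real (k choose a) / real (N choose a) - (real k / real N) ^ a\<bar> \<le> real (a\<^sup>2) / real N"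
proof (cases "k < a")
  case True
  have "(real k / real N) ^ a \<le> (real k / real N) ^ 1"
    using assms True by (intro power_decreasing) auto
  also have "\<dots> \<le> real (a\<^sup>2) / real N"
  proof -
    have "k \<le> a\<^sup>2" using True by (simp add: power2_eq_square) (meson le_square less_imp_le order_trans)
    then have "real k \<le> real (a\<^sup>2)" by (rule of_nat_mono)
    then show ?thesis by (simp add: divide_right_mono)
  qed
  finally show ?thesis using True by (simp add: binomial_eq_0)
next
  case False
  then have "a \<le> k" by simp
  then show ?thesis
  proof (induction a)
    case (Suc a)
    define q x where "q = real (k choose a) / real (N choose a)" and "x = real k / real N"
    \<comment> \<open>The factor that the ratio gains in passing from \<open>a\<close> to
      \<open>Suc a\<close>. The errors add up by \<open>a^2 + a \<le> (Suc a)^2\<close>.\<close>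
    define z where "z = (real k - real a) / (real N - real a)"
    have absorb: "real (n choose Suc a) = real (n choose a) * (real n - real a) / real (Suc a)"
      if "Suc a \<le> n" for n
    proof -
      have "Suc a * (n choose Suc a) = (n choose a) * (n - a)"
        using binomial_absorb_comp[of n a] binomial_absorption[of a n] by (simp add: mult.commute)
      then have "real (Suc a) * real (n choose Suc a) = real (n choose a) * real (n - a)"
        by (metis of_nat_mult)
      then show ?thesis using that by (simp add: field_simps of_nat_diff)
    qed
    have step: "real (k choose Suc a) / real (N choose Suc a) = q * z"
      using Suc.prems assms by (simp add: absorb q_def z_def)
    have "0 \<le> x" "x \<le> 1" "0 \<le> z"
      using assms Suc.prems by (auto simp: x_def z_def)
    have "q \<ge> 0" by (simp add: q_def)
    have "q \<le> 1"
      using assms Suc.prems binomial_right_mono[of k N a] by (simp add: q_def divide_le_eq_1)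
    have "x - z = real a * (real N - real k) / (real N * (real N - real a))"
      using Suc.prems assms by (simp add: x_def z_def field_simps)
    also have "\<dots> = real a / real N * ((real N - real k) / (real N - real a))" by simp
    finally have xz: "x - z = real a / real N * ((real N - real k) / (real N - real a))" .
    have "0 \<le> (real N - real k) / (real N - real a)" "(real N - real k) / (real N - real a) \<le> 1"
      using Suc.prems assms by (auto simp: divide_le_eq_1)
    then have "0 \<le> x - z" "x - z \<le> real a / real N"
      unfolding xz by (intro mult_nonneg_nonneg mult_left_le; simp)+
    then have "\<bar>x - z\<bar> \<le> real a / real N" by simp
    have "\<bar>q * z - x ^ Suc a\<bar> = \<bar>(q - x ^ a) * x - q * (x - z)\<bar>"
      by (simp add: algebra_simps)
    also have "\<dots> \<le> \<bar>q - x ^ a\<bar> * x + q * \<bar>x - z\<bar>"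
      using \<open>0 \<le> x\<close> \<open>q \<ge> 0\<close> abs_triangle_ineq4[of "(q - x ^ a) * x" "q * (x - z)"]
      by (simp add: abs_mult)
    also have "\<dots> \<le> real (a\<^sup>2) / real N * 1 + 1 * (real a / real N)"
      using Suc \<open>\<bar>x - z\<bar> \<le> _\<close> \<open>0 \<le> x\<close> \<open>x \<le> 1\<close> \<open>q \<le> 1\<close> \<open>q \<ge> 0\<close>
      by (intro add_mono mult_mono) (auto simp: q_def x_def)
    also have "\<dots> = real (a\<^sup>2 + a) / real N" by (simp add: add_divide_distrib)
    also have "\<dots> \<le> real ((Suc a)\<^sup>2) / real N"
      by (intro divide_right_mono of_nat_mono) (auto simp: power2_eq_square)
    finally show ?case unfolding step x_def .
  qed simp
qed

text \<open>Degree elevation: multiply \<open>u ^ a\<close> by \<open>(u + v) ^ (N - a) = 1\<close>,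
  expand binomially and rewrite the coefficients in the Bernstein basis of degree
  \<open>N\<close>.\<close>

lemma power_eq_Bernstein_sum:
  fixes u v :: "'n real_mpoly"
  assumes "u + v = 1" "a \<le> N"
  shows "u ^ a = (\<Sum>k\<le>N. const_mpoly (real (k choose a) / real (N choose a)) *
      (const_mpoly (real (N choose k)) * u ^ k * v ^ (N - k)))"
proof -
  have coeff: "of_nat ((N - a) choose j)
      = const_mpoly (real ((a + j) choose a) / real (N choose a)) * const_mpoly (real (N choose (a + j)))"
    if "j \<le> N - a" for j
  proof -
    have "(N choose (a + j)) * ((a + j) choose a) = (N choose a) * ((N - a) choose j)"
      using choose_mult[of a "a + j" N] that assms(2) by simp
    then have "real (N choose (a + j)) * real ((a + j) choose a) = real (N choose a) * real ((N - a) choose j)"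
      by (metis of_nat_mult)
    then have "real ((N - a) choose j) = real ((a + j) choose a) / real (N choose a) * real (N choose (a + j))"
      using assms(2) by (simp add: field_simps)
    then show ?thesis by (simp flip: const_mpoly_mult const_mpoly_of_nat)
  qed
  have "u ^ a = u ^ a * (u + v) ^ (N - a)" using assms(1) by simp
  also have "\<dots> = (\<Sum>j\<le>N - a. of_nat ((N - a) choose j) * (u ^ (a + j) * v ^ (N - (a + j))))"
    by (simp add: binomial_ring sum_distrib_left power_add mult_ac)
  also have "\<dots> = (\<Sum>j\<le>N - a. const_mpoly (real ((a + j) choose a) / real (N choose a)) *
      (const_mpoly (real (N choose (a + j))) * u ^ (a + j) * v ^ (N - (a + j))))"
    by (intro sum.cong refl) (simp add: coeff mult.assoc)
  also have "\<dots> = (\<Sum>k\<in>{a..N}. const_mpoly (real (k choose a) / real (N choose a)) *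
      (const_mpoly (real (N choose k)) * u ^ k * v ^ (N - k)))"
    by (rule sum.reindex_bij_witness[of _ "\<lambda>k. k - a" "\<lambda>j. a + j"]) (use assms(2) in auto)
  \<comment> \<open>The added terms with \<open>k < a\<close> vanish because
    \<open>k choose a = 0\<close>.\<close>
  also have "\<dots> = (\<Sum>k\<le>N. const_mpoly (real (k choose a) / real (N choose a)) *
      (const_mpoly (real (N choose k)) * u ^ k * v ^ (N - k)))"
    by (intro sum.mono_neutral_left) (auto simp: not_le binomial_eq_0)
  finally show ?thesis .
qed

text \<open>The Bernstein coefficients of degree \<open>N\<close> approach the values of
  \<open>p\<close> at the grid points where \<open>u i\<close> equals \<open>\<kappa> i / N\<close>,
  with an error of order \<open>1 / N\<close>. For a monomial in the \<open>u i\<close> they are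
  products of the binomial ratios estimated above; the rest is linearity.\<close>

lemma Bernstein_expansion:
  fixes u v :: "'n::finite \<Rightarrow> 'n real_mpoly" and x :: "nat \<Rightarrow> ('n \<Rightarrow> nat) \<Rightarrow> real ^ 'n"
  assumes uv: "\<And>i. u i + v i = 1"
    and x: "\<And>N \<kappa> i. N > 0 \<Longrightarrow> eval_mpoly (u i) (x N \<kappa>) = real (\<kappa> i) / real N"
    and p: "ell1 u d p"
  shows "\<exists>C N0. \<forall>N\<ge>N0. N > 0 \<longrightarrow> (\<exists>c. p = (\<Sum>\<kappa>\<in>PiE UNIV (\<lambda>_. {..N}). const_mpoly (c \<kappa>) *
      (\<Prod>i\<in>UNIV. const_mpoly (real (N choose \<kappa> i)) * u i ^ \<kappa> i * v i ^ (N - \<kappa> i)))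
      \<and> (\<forall>\<kappa>\<in>PiE UNIV (\<lambda>_. {..N}). \<bar>c \<kappa> - eval_mpoly p (x N \<kappa>)\<bar> \<le> C / N))"
  using p
proof (induction rule: ell1.induct)
  case zero
  show ?case by (intro exI[of _ 0] exI[of _ "\<lambda>_. 0"] allI impI) simp
next
  case (add_monomial d p c0 a)
  define Be where "Be N \<kappa> =
    (\<Prod>i\<in>UNIV. const_mpoly (real (N choose \<kappa> i)) * u i ^ \<kappa> i * v i ^ (N - \<kappa> i))" for N \<kappa>
  define G :: "nat \<Rightarrow> ('n \<Rightarrow> nat) set" where "G N = PiE UNIV (\<lambda>_. {..N})" for N
  obtain C N0 where IH: "\<And>N. N \<ge> N0 \<Longrightarrow> N > 0 \<Longrightarrow>
      \<exists>c. p = (\<Sum>\<kappa>\<in>G N. const_mpoly (c \<kappa>) * Be N \<kappa>)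
        \<and> (\<forall>\<kappa>\<in>G N. \<bar>c \<kappa> - eval_mpoly p (x N \<kappa>)\<bar> \<le> C / N)"
    using add_monomial.IH unfolding Be_def G_def by blast
  define C1 where "C1 = C + \<bar>c0\<bar> * (\<Sum>i\<in>UNIV. real ((a i)\<^sup>2))"
  define q where "q = (\<Prod>i\<in>UNIV. u i ^ a i)"
  have *: "\<exists>c. p + const_mpoly c0 * q = (\<Sum>\<kappa>\<in>G N. const_mpoly (c \<kappa>) * Be N \<kappa>)
        \<and> (\<forall>\<kappa>\<in>G N. \<bar>c \<kappa> - eval_mpoly (p + const_mpoly c0 * q) (x N \<kappa>)\<bar> \<le> C1 / N)"
    if N: "N \<ge> max N0 (sum a UNIV)" "N > 0" for N
  proof -
    obtain c where c: "p = (\<Sum>\<kappa>\<in>G N. const_mpoly (c \<kappa>) * Be N \<kappa>)"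
      and c_le: "\<And>\<kappa>. \<kappa> \<in> G N \<Longrightarrow> \<bar>c \<kappa> - eval_mpoly p (x N \<kappa>)\<bar> \<le> C / N"
      using IH[of N] N by auto
    have aN: "a i \<le> N" for i
      using member_le_sum[of i UNIV a] N by simp
    define c' where "c' \<kappa> = (\<Prod>i\<in>UNIV. real (\<kappa> i choose a i) / real (N choose a i))" for \<kappa>
    have "q = (\<Prod>i\<in>UNIV. \<Sum>k\<le>N. const_mpoly (real (k choose a i) / real (N choose a i)) *
        (const_mpoly (real (N choose k)) * u i ^ k * v i ^ (N - k)))"
      unfolding q_def by (intro prod.cong refl power_eq_Bernstein_sum uv aN)
    also have "\<dots> = (\<Sum>\<kappa>\<in>G N. const_mpoly (c' \<kappa>) * Be N \<kappa>)"
      by (subst prod_sum_PiE) (simp_all add: G_def c'_def Be_def prod.distrib const_mpoly_prod)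
    finally have q: "q = (\<Sum>\<kappa>\<in>G N. const_mpoly (c' \<kappa>) * Be N \<kappa>)" .
    have c'_le: "\<bar>c' \<kappa> - eval_mpoly q (x N \<kappa>)\<bar> \<le> (\<Sum>i\<in>UNIV. real ((a i)\<^sup>2)) / N" if "\<kappa> \<in> G N" for \<kappa>
    proof -
      have \<kappa>: "\<kappa> i \<le> N" for i using that by (auto simp: G_def)
      \<comment> \<open>All factors lie between 0 and 1, so the difference of the products is at
        most the sum of the differences of the factors.\<close>
      have "\<bar>c' \<kappa> - eval_mpoly q (x N \<kappa>)\<bar>
          \<le> (\<Sum>i\<in>UNIV. \<bar>real (\<kappa> i choose a i) / real (N choose a i) - (real (\<kappa> i) / real N) ^ a i\<bar>)"
        unfolding c'_def q_def eval_mpoly_prod eval_mpoly_power x[OF N(2)] real_norm_def[symmetric]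
        by (intro norm_prod_diff)
          (use \<kappa> N binomial_right_mono[OF \<kappa>] in \<open>auto simp: divide_le_eq_1 power_le_one\<close>)
      also have "\<dots> \<le> (\<Sum>i\<in>UNIV. real ((a i)\<^sup>2) / real N)"
        by (intro sum_mono binomial_ratio_approx \<kappa> aN N)
      finally show ?thesis by (simp add: sum_divide_distrib)
    qed
    show ?thesis
    proof (intro exI[of _ "\<lambda>\<kappa>. c \<kappa> + c0 * c' \<kappa>"] conjI ballI)
      show "p + const_mpoly c0 * q = (\<Sum>\<kappa>\<in>G N. const_mpoly (c \<kappa> + c0 * c' \<kappa>) * Be N \<kappa>)"
        by (subst c, subst q)
          (simp add: const_mpoly_add const_mpoly_mult distrib_right sum.distrib sum_distrib_left mult.assoc)
    next
      fix \<kappa> assume "\<kappa> \<in> G N"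
      have "\<bar>c \<kappa> + c0 * c' \<kappa> - eval_mpoly (p + const_mpoly c0 * q) (x N \<kappa>)\<bar>
          = \<bar>(c \<kappa> - eval_mpoly p (x N \<kappa>)) + c0 * (c' \<kappa> - eval_mpoly q (x N \<kappa>))\<bar>"
        by (simp add: algebra_simps)
      also have "\<dots> \<le> \<bar>c \<kappa> - eval_mpoly p (x N \<kappa>)\<bar> + \<bar>c0\<bar> * \<bar>c' \<kappa> - eval_mpoly q (x N \<kappa>)\<bar>"
        by (metis abs_mult abs_triangle_ineq)
      also have "\<dots> \<le> C / N + \<bar>c0\<bar> * ((\<Sum>i\<in>UNIV. real ((a i)\<^sup>2)) / N)"
        by (intro add_mono mult_left_mono c_le c'_le \<open>\<kappa> \<in> G N\<close>) auto
      also have "\<dots> = C1 / N" by (simp add: C1_def add_divide_distrib)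
      finally show "\<bar>c \<kappa> + c0 * c' \<kappa> - eval_mpoly (p + const_mpoly c0 * q) (x N \<kappa>)\<bar> \<le> C1 / N" .
    qed
  qed
  show ?case
    by (intro exI[of _ C1] exI[of _ "max N0 (sum a UNIV)"] allI impI)
      (rule *[unfolded q_def Be_def G_def])
qed

lemma positive_on_box_in_sos_closure:
  fixes p :: "'n::finite real_mpoly"
  assumes "b > 0" and pos: "\<And>x. x \<in> cbox (\<chi> i. - b) (\<chi> i. b) \<Longrightarrow> eval_mpoly p x > 0"
  shows "p \<in> sos_closure (\<lambda>i. const_mpoly (1 / b) * var_mpoly i)"
proof -
  define y :: "'n \<Rightarrow> 'n real_mpoly" where "y = (\<lambda>i. const_mpoly (1 / b) * var_mpoly i)"
  \<comment> \<open>Barycentric coordinates of the interval from \<open>-b\<close> to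
    \<open>b\<close>: they sum to 1 and are half of \<open>1 \<plusminus> y i\<close>.\<close>
  define u v where "u i = const_mpoly (1/2) * (1 + y i)" and "v i = const_mpoly (1/2) * (1 - y i)" for i
  define x :: "nat \<Rightarrow> ('n \<Rightarrow> nat) \<Rightarrow> real ^ 'n"
    where "x N \<kappa> = (\<chi> i. b * (2 * (real (\<kappa> i) / real N) - 1))" for N \<kappa>
  have half: "const_mpoly (1/2) + const_mpoly (1/2) = (1 :: 'n real_mpoly)"
    by (simp flip: const_mpoly_add)
  have uv: "u i + v i = 1" for i
    unfolding u_def v_def distrib_left[symmetric] using half by (simp add: distrib_left algebra_simps)
  have ux: "eval_mpoly (u i) (x N \<kappa>) = real (\<kappa> i) / real N" for i N \<kappa>
    using \<open>b > 0\<close> by (simp add: u_def y_def x_def field_simps)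
  have var_y: "var_mpoly i = const_mpoly b * y i" for i
    using \<open>b > 0\<close> by (simp add: y_def mult.assoc[symmetric] flip: const_mpoly_mult)
  have y_u: "y i = const_mpoly 2 * u i + const_mpoly (-1)" for i
    by (simp add: u_def mult.assoc[symmetric] const_mpoly_minus flip: const_mpoly_mult)
  have "\<exists>d. ell1 u d (var_mpoly i)" for i
    unfolding var_y y_u
    using ell1_mult[OF ell1_const[of u b] ell1_add[OF ell1_mult[OF ell1_const[of u 2]
        ell1_generator[of u i]] ell1_const[of u "-1"]]] by (rule exI)
  then obtain d where d: "ell1 u d p" using ell1_exists by blast
  obtain C N0 where CN: "\<forall>N\<ge>N0. N > 0 \<longrightarrow> (\<exists>c. p = (\<Sum>\<kappa>\<in>PiE UNIV (\<lambda>_. {..N}). const_mpoly (c \<kappa>) *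
      (\<Prod>i\<in>UNIV. const_mpoly (real (N choose \<kappa> i)) * u i ^ \<kappa> i * v i ^ (N - \<kappa> i)))
      \<and> (\<forall>\<kappa>\<in>PiE UNIV (\<lambda>_. {..N}). \<bar>c \<kappa> - eval_mpoly p (x N \<kappa>)\<bar> \<le> C / N))"
    using Bernstein_expansion[OF uv ux d] by (elim exE that)
  have "(0 :: real ^ 'n) \<in> cbox (\<chi> i. - b) (\<chi> i. b)"
    using \<open>b > 0\<close> by (simp add: mem_box_cart)
  then obtain x0 where x0: "x0 \<in> cbox (\<chi> i. - b) (\<chi> i. b)"
    and min: "\<And>z. z \<in> cbox (\<chi> i. - b) (\<chi> i. b) \<Longrightarrow> eval_mpoly p x0 \<le> eval_mpoly p z"
    using continuous_attains_inf[OF compact_cbox _ continuous_on_eval_mpoly] by (metis empty_iff)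
  obtain n where "C / eval_mpoly p x0 < real n"
    using reals_Archimedean2 by blast
  \<comment> \<open>Large enough that the \<open>C / N\<close> error stays below the minimum of
    \<open>p\<close> on the box, which makes all Bernstein coefficients nonnegative.\<close>
  define N where "N = max n (max N0 1)"
  have N: "N \<ge> N0" "C / eval_mpoly p x0 < real N"
    using \<open>_ < real n\<close> by (auto simp: N_def)
  have "N > 0" by (simp add: N_def)
  with N pos[OF x0] have small: "C / N < eval_mpoly p x0" by (simp add: field_simps)
  obtain c where c: "p = (\<Sum>\<kappa>\<in>PiE UNIV (\<lambda>_. {..N}). const_mpoly (c \<kappa>) *
      (\<Prod>i\<in>UNIV. const_mpoly (real (N choose \<kappa> i)) * u i ^ \<kappa> i * v i ^ (N - \<kappa> i)))"
    and c_le: "\<forall>\<kappa>\<in>PiE UNIV (\<lambda>_. {..N}). \<bar>c \<kappa> - eval_mpoly p (x N \<kappa>)\<bar> \<le> C / N"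
    using CN[rule_format, OF N(1) \<open>N > 0\<close>] by (elim exE conjE that)
  have c_nonneg: "c \<kappa> \<ge> 0" if "\<kappa> \<in> PiE UNIV (\<lambda>_. {..N})" for \<kappa>
  proof -
    have "real (\<kappa> i) / real N \<le> 1" for i using that \<open>N > 0\<close> by (auto simp: divide_le_eq_1)
    then have "0 \<le> b * (real (\<kappa> i) / real N)" "b * (real (\<kappa> i) / real N) \<le> b" for i
      using \<open>b > 0\<close> by (simp, intro mult_left_le) auto
    moreover have "x N \<kappa> $ i = 2 * (b * (real (\<kappa> i) / real N)) - b" for i
      by (simp add: x_def algebra_simps)
    ultimately have "- b \<le> x N \<kappa> $ i \<and> x N \<kappa> $ i \<le> b" for i by smt
    then have "x N \<kappa> \<in> cbox (\<chi> i. - b) (\<chi> i. b)" by (simp add: mem_box_cart)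
    from min[OF this] c_le[rule_format, OF that] small show ?thesis by linarith
  qed
  \<comment> \<open>Products in \<open>sos_closure\<close> require \<open>ell1\<close> bounds on the
    factors; carrying such a bound along makes the set multiplicatively closed.\<close>
  define P where "P = {q \<in> sos_closure y. \<exists>d. ell1 y d q}"
  have P_mult: "q * r \<in> P" if "q \<in> P" "r \<in> P" for q r
    using that ell1_mult unfolding P_def by (blast intro: sos_closure_mult)
  have P_const: "const_mpoly c \<in> P" if "c \<ge> 0" for c
    using sos_closure_sos[OF sos_const[OF that]] ell1_const[of y c] unfolding P_def by blast
  have P_power: "q ^ k \<in> P" if "q \<in> P" for q k
    by (induction k) (use that P_mult P_const[of 1] in auto)
  have P_prod: "prod q I \<in> P" if "\<And>i. q i \<in> P" for q and I :: "'n set"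
    by (induction I rule: infinite_finite_induct) (use that P_mult P_const[of 1] in auto)
  have "1 - y i \<in> P" for i
    using one_minus_in_sos_closure[OF ell1_generator[of y i]]
      ell1_add[OF ell1_const[of y 1] ell1_minus[OF ell1_generator[of y i]]] by (auto simp: P_def)
  then have v: "v i \<in> P" for i unfolding v_def by (intro P_mult P_const) auto
  \<comment> \<open>The case \<open>t = - y i\<close> of the square root argument.\<close>
  have "1 + y i \<in> P" for i
    using one_minus_in_sos_closure[OF ell1_minus[OF ell1_generator[of y i]]]
      ell1_add[OF ell1_const[of y 1] ell1_generator[of y i]] by (auto simp: P_def)
  then have u: "u i \<in> P" for i unfolding u_def by (intro P_mult P_const) auto
  have "const_mpoly (c \<kappa>) *
      (\<Prod>i\<in>UNIV. const_mpoly (real (N choose \<kappa> i)) * u i ^ \<kappa> i * v i ^ (N - \<kappa> i)) \<in> sos_closure y"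
    if "\<kappa> \<in> PiE UNIV (\<lambda>_. {..N})" for \<kappa>
  proof -
    have "const_mpoly (c \<kappa>) *
        (\<Prod>i\<in>UNIV. const_mpoly (real (N choose \<kappa> i)) * u i ^ \<kappa> i * v i ^ (N - \<kappa> i)) \<in> P"
      by (intro P_mult P_prod P_power P_const u v c_nonneg that) auto
    then show ?thesis by (simp add: P_def)
  qed
  then show ?thesis
    unfolding y_def[symmetric] by (subst c) (rule sos_closure_sum)
qed

subsection \<open>The penalty polynomials\<close>

text \<open>With \<open>s = t / R\<close>, Bernoulli gives \<open>n * s \<le> (1 + s) ^ n\<close>,
  and \<open>(1 + s) ^ n * (1 - s) ^ n = (1 - s^2) ^ n \<le> 1\<close>.\<close>

lemma penalty_upper:
  fixes R t :: real
  assumes "0 \<le> t" "t \<le> R" "n > 0"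
  shows "t * (1 - t / R) ^ n \<le> R / n"
proof (cases "t = 0")
  case False
  define s where "s = t / R"
  have s: "0 \<le> s" "s \<le> 1" "t = R * s" using assms False by (auto simp: s_def)
  have "real n * s * (1 - s) ^ n \<le> (1 + s) ^ n * (1 - s) ^ n"
    using s Bernoulli_inequality[of s n] by (intro mult_right_mono) auto
  also have "\<dots> = (1 - s\<^sup>2) ^ n"
    by (simp add: power2_eq_square algebra_simps flip: power_mult_distrib)
  also have "\<dots> \<le> 1" using s by (intro power_le_one) (auto simp: power_le_one)
  finally have "s * (1 - s) ^ n \<le> 1 / n" using assms by (simp add: field_simps)
  then have "R * (s * (1 - s) ^ n) \<le> R * (1 / n)" using assms by (intro mult_left_mono) auto
  then show ?thesis using s by (simp add: s_def[symmetric] mult.assoc)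
qed (use assms in simp)

text \<open>The degenerate case \<open>R = 0\<close>, where \<open>t / R = 0\<close>, is harmless because then \<open>t = 0\<close>.\<close>

lemma penalty_lower:
  fixes R t :: real
  assumes "\<bar>t\<bar> \<le> R" "R < S" "n > 0"
  shows "- (t * (1 - t / R) ^ n) \<ge> real n / S * (min 0 t)\<^sup>2 - R / n"
proof (cases "t \<ge> 0")
  case True
  then show ?thesis using penalty_upper[of t R n] assms by simp
next
  case False
  then have R: "R > 0" "S > 0" using assms by auto
  \<comment> \<open>For negative \<open>t\<close> the base \<open>1 - t / R\<close> exceeds 1, and
    the linear term of Bernoulli times \<open>- t\<close> is the quadratic penalty. Weakening
    \<open>R\<close> to \<open>S\<close> allows one constant for all constraints.\<close>
  have "real n / S * t\<^sup>2 \<le> - t * (1 + real n * (- t / R))"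
  proof -
    have "real n / S * t\<^sup>2 \<le> real n / R * t\<^sup>2"
      using R assms by (intro mult_right_mono divide_left_mono) auto
    also have "\<dots> \<le> - t * (1 + real n * (- t / R))"
      using False by (simp add: power2_eq_square algebra_simps)
    finally show ?thesis .
  qed
  also have "\<dots> \<le> - t * (1 + - t / R) ^ n"
  proof (rule mult_left_mono[OF Bernoulli_inequality])
    have "- t / R \<ge> 0" using False R by (intro divide_nonneg_nonneg) auto
    then show "- t / R \<ge> - 1" by linarith
  qed (use False in auto)
  finally have "real n / S * t\<^sup>2 \<le> - (t * (1 - t / R) ^ n)" by simp
  moreover have "R / n \<ge> 0" using R by simp
  ultimately show ?thesis using False by simp
qed

text \<open>On the compact set where \<open>F \<le> 0\<close>, the function \<open>h\<close> is
  bounded away from 0, so a large multiple of it outweighs \<open>F\<close>; elsewhere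
  \<open>F\<close> is already positive. Compactness of \<open>B\<close> then gives the uniform
  \<open>\<delta>\<close>.\<close>

lemma compact_penalty:
  fixes F h :: "'a::metric_space \<Rightarrow> real"
  assumes B: "compact B" and F: "continuous_on B F" and h: "continuous_on B h"
    and nonneg: "\<And>x. x \<in> B \<Longrightarrow> h x \<ge> 0"
    and pos: "\<And>x. x \<in> B \<Longrightarrow> h x = 0 \<Longrightarrow> F x > 0"
  shows "\<exists>c>0. \<exists>\<delta>>0. \<forall>x\<in>B. F x + c * h x \<ge> \<delta>"
proof -
  have bounded_below: "\<exists>\<delta>>0. \<forall>x\<in>C. G x \<ge> \<delta>"
    if C: "compact C" and G: "continuous_on C G" "\<And>x. x \<in> C \<Longrightarrow> G x > 0" for C and G :: "'a \<Rightarrow> real"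
  proof (cases "C = {}")
    case False
    with continuous_attains_inf[OF C False G(1)] G(2) show ?thesis by metis
  qed (auto intro: exI[of _ 1])
  define C where "C = {x \<in> B. F x \<le> 0}"
  have "C = B \<inter> F -` {..0}" by (auto simp: C_def)
  moreover have "closed (B \<inter> F -` {..0})"
    using continuous_closed_preimage[OF F compact_imp_closed[OF B] closed_atMost] .
  ultimately have "compact C"
    using compact_Int_closed[OF B] by (metis inf.left_idem)
  have "h x > 0" if "x \<in> C" for x
    using that pos[of x] nonneg[of x] by (force simp: C_def)
  then obtain \<eta> where \<eta>: "\<eta> > 0" "\<And>x. x \<in> C \<Longrightarrow> h x \<ge> \<eta>"
    using bounded_below[OF \<open>compact C\<close> continuous_on_subset[OF h]] by (auto simp: C_def)
  have "compact (F ` B)" using F B by (rule compact_continuous_image)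
  then obtain L where L: "L > 0" "\<And>x. x \<in> B \<Longrightarrow> \<bar>F x\<bar> \<le> L"
    using compact_imp_bounded bounded_pos by (metis imageI real_norm_def)
  \<comment> \<open>This gives \<open>c * h \<ge> 2 * L\<close> where \<open>F \<le> 0\<close>,
    while \<open>F \<ge> - L\<close> everywhere on \<open>B\<close>.\<close>
  define c where "c = 2 * L / \<eta>"
  have "c > 0" using L \<eta> by (simp add: c_def)
  have "F x + c * h x > 0" if "x \<in> B" for x
  proof (cases "x \<in> C")
    case True
    have "2 * L = c * \<eta>" using \<eta> by (simp add: c_def)
    also have "\<dots> \<le> c * h x" using \<open>c > 0\<close> \<eta>(2)[OF True] by simp
    finally show ?thesis using L(1) L(2)[OF that] by linarith
  next
    case False
    then have "F x > 0" using that by (auto simp: C_def)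
    then show ?thesis using nonneg[OF that] \<open>c > 0\<close> by (simp add: add_pos_nonneg)
  qed
  moreover have "continuous_on B (\<lambda>x. F x + c * h x)" by (intro continuous_intros F h)
  ultimately show ?thesis using bounded_below[OF B] \<open>c > 0\<close> by blast
qed

lemma abs_le_max_abs_on:
  assumes "compact B" "x \<in> B"
  shows "\<bar>eval_mpoly p x\<bar> \<le> max_abs_on B p"
proof -
  have "compact ((\<lambda>x. \<bar>eval_mpoly p x\<bar>) ` B)"
    by (intro compact_continuous_image continuous_intros continuous_on_eval_mpoly assms)
  then have "bdd_above ((\<lambda>x. \<bar>eval_mpoly p x\<bar>) ` B)"
    by (simp add: bounded_imp_bdd_above compact_imp_bounded)
  then show ?thesis
    unfolding max_abs_on_def using assms(2) by (rule cSUP_upper2) simp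
qed

lemma eventually_positive_add_psi:
  fixes f :: "'n::finite real_mpoly"
  assumes "compact B" and R: "\<And>j. j \<in> {1..m} \<Longrightarrow> R j = max_abs_on B (g j)"
    and pos: "\<And>x. x \<in> B \<inter> feasible_set m g \<Longrightarrow> eval_mpoly f x > 0"
  shows "\<exists>r0\<ge>1. \<forall>r\<ge>r0. \<forall>x\<in>B. eval_mpoly (f + psi m g R r) x > 0"
proof -
  define h where "h x = (\<Sum>j=1..m. (min 0 (eval_mpoly (g j) x))\<^sup>2)" for x
  have "continuous_on B h"
    unfolding h_def by (intro continuous_intros continuous_on_eval_mpoly)
  moreover have "h x \<ge> 0" for x by (simp add: h_def sum_nonneg)
  moreover have "eval_mpoly f x > 0" if "x \<in> B" "h x = 0" for x
  proof -
    have "\<forall>j\<in>{1..m}. (min 0 (eval_mpoly (g j) x))\<^sup>2 = 0"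
      using that(2) unfolding h_def by (subst (asm) sum_nonneg_eq_0_iff) auto
    then show ?thesis using that(1) by (intro pos) (auto simp: feasible_set_def min_def split: if_splits)
  qed
  ultimately obtain c \<delta> where c: "c > 0" and \<delta>: "\<delta> > 0"
    and le: "\<And>x. x \<in> B \<Longrightarrow> eval_mpoly f x + c * h x \<ge> \<delta>"
    using compact_penalty[OF assms(1) continuous_on_eval_mpoly] by metis
  have g_le: "\<bar>eval_mpoly (g j) x\<bar> \<le> R j" if "x \<in> B" "j \<in> {1..m}" for x j
    using abs_le_max_abs_on[OF assms(1) that(1)] R[OF that(2)] by simp
  \<comment> \<open>\<open>A\<close> bounds the sum of the \<open>R j\<close>, and \<open>S\<close>
    strictly exceeds each of them and is positive even for \<open>m = 0\<close>.\<close>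
  define A S where "A = (\<Sum>j=1..m. \<bar>R j\<bar>)" and "S = A + 1"
  have "A \<ge> 0" by (simp add: A_def sum_nonneg)
  have R_less: "R j < S" if "j \<in> {1..m}" for j
    using member_le_sum[OF that, of "\<lambda>j. \<bar>R j\<bar>"] by (simp add: S_def A_def)
  \<comment> \<open>The two bounds give \<open>n / S \<ge> c\<close>, so the penalty dominates
    \<open>c * h\<close>, and \<open>A / n < \<delta>\<close>, so the total loss from nonnegative
    constraint values stays below the margin.\<close>
  obtain r0 :: nat where r0: "max (c * S) (A / \<delta>) < r0"
    using reals_Archimedean2 by blast
  have "eval_mpoly (f + psi m g R r) x > 0" if r: "r \<ge> max 1 r0" and x: "x \<in> B" for r x
  proof -
    define n where "n = 2 * r"
    have n: "n > 0" "c * S < n" "A / \<delta> < n" using r r0 by (auto simp: n_def)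
    have "A / n < \<delta>" using n \<delta> by (simp add: field_simps)
    have "real n / S * h x - A / n \<le> (\<Sum>j=1..m. real n / S * (min 0 (eval_mpoly (g j) x))\<^sup>2 - R j / n)"
    proof -
      have "(\<Sum>j=1..m. R j) \<le> A" unfolding A_def by (intro sum_mono) simp
      then have "(\<Sum>j=1..m. R j) / n \<le> A / n" by (intro divide_right_mono) auto
      then show ?thesis by (simp add: h_def sum_subtractf sum_distrib_left sum_divide_distrib)
    qed
    also have "\<dots> \<le> (\<Sum>j=1..m. - (eval_mpoly (g j) x * (1 - eval_mpoly (g j) x / R j) ^ n))"
      using x by (intro sum_mono penalty_lower g_le R_less n) auto
    also have "\<dots> = eval_mpoly (psi m g R r) x"
      by (simp add: psi_def n_def sum_negf)
    finally have "eval_mpoly (f + psi m g R r) x \<ge> eval_mpoly f x + real n / S * h x - A / n" by simp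
    moreover have "c * h x \<le> real n / S * h x"
      using n(2) \<open>h x \<ge> 0\<close> \<open>A \<ge> 0\<close> by (intro mult_right_mono) (auto simp: S_def field_simps)
    ultimately show ?thesis using le[OF x] \<open>A / n < \<delta>\<close> by linarith
  qed
  then show ?thesis by (intro exI[of _ "max 1 r0"]) auto
qed

section \<open>Positivity on the box and the perturbed sum-of-squares certificate\<close>

theorem theorem1:
  fixes f :: "'n::finite real_mpoly"
    and g :: "nat \<Rightarrow> 'n real_mpoly"
    and m :: nat
    and xopt :: "real ^ 'n"
    and K B :: "(real ^ 'n) set"
    and b \<rho> :: real
    and R :: "nat \<Rightarrow> real"
  assumes g_nonzero: "\<And>j. j \<in> {1..m} \<Longrightarrow> g j \<noteq> 0"
    and K: "K = feasible_set m g"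
    and xopt_feasible: "xopt \<in> K"
    and xopt_minimal: "\<And>x. x \<in> K \<Longrightarrow> eval_mpoly f xopt \<le> eval_mpoly f x"
    and b: "b = max 1 (MAX i. \<bar>xopt $ i\<bar>)"
    and B: "B = cbox (\<chi> i. - b) (\<chi> i. b)"
    and R: "\<And>j. j \<in> {1..m} \<Longrightarrow> R j = max_abs_on B (g j)"
    and rho: "\<And>x. x \<in> B \<inter> K \<Longrightarrow> eval_mpoly f x - \<rho> > 0"
  shows "\<exists>r0\<ge>1.
      (\<forall>r\<ge>r0. \<forall>x\<in>B. eval_mpoly (f - const_mpoly \<rho> + psi m g R r) x > 0) \<and>
      (\<forall>\<epsilon>>0. \<exists>r1\<ge>1. \<forall>r\<ge>r1.
         f - const_mpoly \<rho> + const_mpoly \<epsilon> * Theta r b + psi m g R r0 \<in> sums_of_squares)"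
proof -
  define F where "F = f - const_mpoly \<rho>"
  have "b \<ge> 1" by (simp add: b)
  have "compact B" by (simp add: B)
  have "eval_mpoly F x > 0" if "x \<in> B \<inter> feasible_set m g" for x
    using rho[of x] that by (simp add: F_def K)
  from eventually_positive_add_psi[of B m R g F, OF \<open>compact B\<close> R this] obtain r0 where "r0 \<ge> 1"
    and pos: "\<forall>r\<ge>r0. \<forall>x\<in>B. eval_mpoly (F + psi m g R r) x > 0"
    by blast
  have "\<exists>r1\<ge>1. \<forall>r\<ge>r1. F + const_mpoly \<epsilon> * Theta r b + psi m g R r0 \<in> sums_of_squares"
    if "\<epsilon> > 0" for \<epsilon>
  proof -
    \<comment> \<open>Positivity is used at the exponent \<open>r0\<close> itself, so the same
      \<open>r0\<close> serves every \<open>\<epsilon>\<close>.\<close>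
    have "F + psi m g R r0 \<in> sos_closure (\<lambda>i. const_mpoly (1 / b) * var_mpoly i)"
      using \<open>b \<ge> 1\<close> pos by (intro positive_on_box_in_sos_closure) (auto simp: B)
    from sos_closure_add_Theta[OF this that] obtain r1
      where "\<forall>r\<ge>r1. F + psi m g R r0 + const_mpoly \<epsilon> * Theta r b \<in> sums_of_squares"
      by blast
    then show ?thesis
      by (intro exI[of _ "max 1 r1"]) (simp add: add.commute add.left_commute)
  qed
  with \<open>r0 \<ge> 1\<close> pos show ?thesis unfolding F_def by blast
qed

end
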